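(* Let $H$ be a real Hilbert space, let $A_0\colon \operatorname{dom}(A_0)\subseteq H\to H$ be a densely defined, closed, skew-symmetric linear operator, and set $A:=-A_0^*\supseteq A_0$. Let $B\subseteq A$ be a (not necessarily linear) restriction of $A$. Then $B$ is $m$-accretive if and only if there exists a (not necessarily linear) mapping $h\colon \ker(1-A)\to\ker(1+A)$ with $$\|h(x)-h(y)\|_H\le \|x-y\|_H\quad\text{for all }x,y\in\ker(1-A)$$ such that $$\operatorname{dom}(B)=\{u\in\operatorname{dom}(A)\,;\,h(\pi_1u)=\pi_{-1}u\}.$$
   Context: All Hilbert spaces are real. Skew-symmetric means $A_0\subseteq -A_0^*$. The domain $\operatorname{dom}(A)$ is equipped with the graph inner product $\langle u,v\rangle_{\operatorname{dom}(A)}=\langle u,v\rangle_H+\langle Au,Av\rangle_H$, for which it is a Hilbert space. One has the orthogonal decomposition with respect to this inner product $\operatorname{dom}(A)=\operatorname{dom}(A_0)\oplus\ker(1-A)\oplus\ker(1+A)$; $\pi_1\colon\operatorname{dom}(A)\to\ker(1-A)$ and $\pi_{-1}\colon\operatorname{dom}(A)\to\ker(1+A)$ denote the corresponding (graph-)orthogonal projections. Operators are identified with their graphs; $B\subseteq A$ means that $B$ is the restriction of $A$ to some subset $\operatorname{dom}(B)\subseteq\operatorname{dom}(A)$, which need not be a linear subspace. A relation $B\subseteq H\times H$ is accretive if $\langle y-v,x-u\rangle_H\ge 0$ for all $(u,v),(x,y)\in B$. It is $m$-accretive if it is accretive and $1+B$ is onto, i.e. for each $f\in H$ there is $(u,v)\in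 B$ with $u+v=f$. *)

theory Defs
  imports "HOL-Analysis.Analysis"
begin

(* Operators and relations in H are identified with their graphs, i.e. subsets of H x H.
   The product type carries the product topology and the product Hilbert space structure. *)

definition linear_operator :: "('h::real_vector) rel \<Rightarrow> bool" where
  "linear_operator T \<longleftrightarrow> subspace T \<and> single_valued T"

definition densely_defined :: "('h::topological_space) rel \<Rightarrow> bool" where
  "densely_defined T \<longleftrightarrow> closure (Domain T) = UNIV"

definition op_uminus :: "('h::real_vector) rel \<Rightarrow> 'h rel" where
  "op_uminus T = {(u, - v) | u v. (u, v) \<in> T}"

definition one_plus :: "('h::real_vector) rel \<Rightarrow> 'h rel" where
  "one_plus T = {(u, u + v) | u v. (u, v) \<in> T}"

definition one_minus :: "('h::real_vector) rel \<Rightarrow> 'h rel" where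
  "one_minus T = {(u, u - v) | u v. (u, v) \<in> T}"

definition op_ker :: "('h::real_vector) rel \<Rightarrow> 'h set" where
  "op_ker T = {u. (u, 0) \<in> T}"

(* The adjoint: x is in its domain, with value y, iff <T u, x> = <u, y> for all u in dom T.
   This is single-valued if T is densely defined. *)
definition op_adjoint :: "('h::real_inner) rel \<Rightarrow> 'h rel" where
  "op_adjoint T = {(x, y). \<forall>(u, v) \<in> T. inner v x = inner u y}"

definition skew_symmetric :: "('h::real_inner) rel \<Rightarrow> bool" where
  "skew_symmetric T \<longleftrightarrow> T \<subseteq> op_uminus (op_adjoint T)"

(* Value of a single-valued T at u; meaningful only for u in Domain T. *)
definition op_apply :: "'h rel \<Rightarrow> 'h \<Rightarrow> 'h" where
  "op_apply T u = (THE v. (u, v) \<in> T)"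

definition graph_inner :: "('h::real_inner) rel \<Rightarrow> 'h \<Rightarrow> 'h \<Rightarrow> real" where
  "graph_inner T u v = inner u v + inner (op_apply T u) (op_apply T v)"

(* Orthogonal projection of dom T, with the graph inner product, onto a subspace S of dom T;
   meaningful for u in Domain T and S closed with respect to the graph norm. *)
definition graph_proj :: "('h::real_inner) rel \<Rightarrow> 'h set \<Rightarrow> 'h \<Rightarrow> 'h" where
  "graph_proj T S u = (THE w. w \<in> S \<and> (\<forall>z\<in>S. graph_inner T (u - w) z = 0))"

definition accretive :: "('h::real_inner) rel \<Rightarrow> bool" where
  "accretive B \<longleftrightarrow> (\<forall>(u, v) \<in> B. \<forall>(x, y) \<in> B. inner (y - v) (x - u) \<ge> 0)"

definition m_accretive :: "('h::real_inner) rel \<Rightarrow> bool" where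
  "m_accretive B \<longleftrightarrow> accretive B \<and> Range (one_plus B) = UNIV"

end

theory Submission
  imports Defs
begin

text \<open>
  Write \<open>K\<^sub>+ = ker (1 - A)\<close>, \<open>K\<^sub>- = ker (1 + A)\<close>, and let \<open>\<pi>\<^sub>1\<close>, \<open>\<pi>\<^sub>m\<close> be the graph-orthogonal
  projections onto them. Every \<open>u\<close> in the domain of \<open>A\<close> is \<open>u\<^sub>0 + p + q\<close> with \<open>u\<^sub>0\<close> in the domain
  of \<open>A\<^sub>0\<close>, \<open>p = \<pi>\<^sub>1 u\<close> and \<open>q = \<pi>\<^sub>m u\<close>, and then \<open>A u = A\<^sub>0 u\<^sub>0 + p - q\<close>. Two consequences carry
  the proof.

  The first is the identity \<open>\<langle>A u, u\<rangle> = \<parallel>\<pi>\<^sub>1 u\<parallel>\<^sup>2 - \<parallel>\<pi>\<^sub>m u\<parallel>\<^sup>2\<close>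
  (\<open>inner_eq_norm_proj_diff\<close>). Applied to differences of elements of the domain of \<open>B\<close>, it says
  that \<open>B\<close> is accretive exactly if \<open>\<pi>\<^sub>1 u \<mapsto> \<pi>\<^sub>m u\<close> is a well-defined contraction (with Lipschitz
  constant one) on the image of that domain under \<open>\<pi>\<^sub>1\<close>
  (\<open>accretive_iff_contraction\<close>).

  The second describes the equation \<open>u + A u = f\<close>. Since the kernel of \<open>1 + A\<close> is \<open>K\<^sub>-\<close>, the
  right-hand side \<open>f\<close> determines \<open>\<pi>\<^sub>1 u\<close>, and it determines \<open>u\<close> up to the value of \<open>\<pi>\<^sub>m u\<close>
  (\<open>same_image_imp\<close>); and a solution exists for every \<open>f\<close>, with \<open>\<pi>\<^sub>m u\<close> prescribed freely, even
  as a function of \<open>\<pi>\<^sub>1 u\<close> (\<open>solve_with_prescribed_proj\<close>).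

  Hence if \<open>h\<close> is a contraction on all of \<open>K\<^sub>+\<close>, the condition \<open>h (\<pi>\<^sub>1 u) = \<pi>\<^sub>m u\<close> selects one
  solution for each \<open>f\<close>, so it defines an \<open>m\<close>-accretive operator. Conversely, if \<open>B\<close> is
  \<open>m\<close>-accretive, solving with \<open>f = 2 p\<close> for \<open>p\<close> in \<open>K\<^sub>+\<close> shows that the contraction given by
  accretivity is defined on all of \<open>K\<^sub>+\<close>; and any \<open>u\<close> satisfying \<open>h (\<pi>\<^sub>1 u) = \<pi>\<^sub>m u\<close> agrees with
  the solution in the domain of \<open>B\<close> of the equation with right-hand side \<open>u + A u\<close>.
\<close>

section \<open>Orthogonal projection onto a closed subspace\<close>

lemma parallelogram_midpoint:
  fixes x m m' :: "'a::real_inner"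
  shows "(norm (m - m'))\<^sup>2
    = 2 * (norm (x - m))\<^sup>2 + 2 * (norm (x - m'))\<^sup>2 - 4 * (norm (x - (1/2) *\<^sub>R (m + m')))\<^sup>2"
  by (simp add: power2_norm_eq_inner inner_commute algebra_simps)

text \<open>
  By the parallelogram identity, two points of the subspace that nearly minimise the distance to
  \<open>x\<close> are close to each other, as their midpoint also lies in the subspace. The sets of almost
  minimisers are therefore nested and closed with diameters tending to zero, and completeness
  gives a point in all of them.
\<close>
lemma closest_point_in_closed_subspace:
  fixes M :: "'a::{real_inner, complete_space} set"
  assumes M: "subspace M" "closed M"
  obtains m where "m \<in> M" "\<And>y. y \<in> M \<Longrightarrow> norm (x - m) \<le> norm (x - y)"
proof -
  define d where "d = (INF y\<in>M. (norm (x - y))\<^sup>2)"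
  define S where "S n = {y \<in> M. (norm (x - y))\<^sup>2 \<le> d + 1 / real (Suc n)}" for n
  have "0 \<in> M" using M by (simp add: subspace_0)
  have bdd: "bdd_below ((\<lambda>y. (norm (x - y))\<^sup>2) ` M)"
    by (rule bdd_belowI[of _ 0]) auto
  have d_le: "d \<le> (norm (x - y))\<^sup>2" if "y \<in> M" for y
    unfolding d_def using bdd that by (rule cINF_lower)
  have "closed (S n)" for n
  proof -
    have "closed {y. (norm (x - y))\<^sup>2 \<le> d + 1 / real (Suc n)}"
      by (intro closed_Collect_le continuous_intros)
    moreover have "S n = M \<inter> {y. (norm (x - y))\<^sup>2 \<le> d + 1 / real (Suc n)}"
      by (auto simp: S_def)
    ultimately show ?thesis using M by (simp add: closed_Int)
  qed
  moreover have "S n \<noteq> {}" for n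
  proof -
    have "(INF y\<in>M. (norm (x - y))\<^sup>2) < d + 1 / real (Suc n)"
      unfolding d_def[symmetric] by simp
    then obtain y where "y \<in> M" "(norm (x - y))\<^sup>2 < d + 1 / real (Suc n)"
      using cINF_less_iff[OF _ bdd] \<open>0 \<in> M\<close> by blast
    then show ?thesis unfolding S_def by force
  qed
  moreover have "S n \<subseteq> S m" if "m \<le> n" for m n
  proof -
    have "1 / real (Suc n) \<le> 1 / real (Suc m)"
      using that by (intro divide_left_mono) auto
    then show ?thesis unfolding S_def by auto
  qed
  moreover have "\<exists>n. \<forall>y\<in>S n. \<forall>z\<in>S n. dist y z < e" if "e > 0" for e
  proof -
    obtain n where n: "1 / real (Suc n) < e\<^sup>2 / 4"
      using nat_approx_posE[of "e\<^sup>2 / 4"] \<open>e > 0\<close> by auto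
    have "dist y z < e" if "y \<in> S n" "z \<in> S n" for y z
    proof -
      have "(1/2) *\<^sub>R (y + z) \<in> M"
        using that M by (auto simp: S_def intro!: subspace_scale subspace_add)
      then have "d \<le> (norm (x - (1/2) *\<^sub>R (y + z)))\<^sup>2" by (rule d_le)
      moreover have "(norm (x - y))\<^sup>2 \<le> d + 1 / real (Suc n)"
          "(norm (x - z))\<^sup>2 \<le> d + 1 / real (Suc n)"
        using that by (auto simp: S_def)
      ultimately have "(norm (y - z))\<^sup>2 < e\<^sup>2"
        using parallelogram_midpoint[of y z x] n by linarith
      then show ?thesis
        unfolding dist_norm using \<open>e > 0\<close> by (meson less_imp_le power_less_imp_less_base)
    qed
    then show ?thesis by blast
  qed
  ultimately obtain m where "\<forall>n. m \<in> S n"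
    using decreasing_closed_nest[of S "\<exists>m. \<forall>n. m \<in> S n"] by blast
  then have m: "m \<in> S n" for n by blast
  have "(norm (x - m))\<^sup>2 \<le> d"
  proof (rule field_le_epsilon)
    fix e :: real assume "e > 0"
    then obtain n where "1 / real (Suc n) < e" by (rule nat_approx_posE)
    then show "(norm (x - m))\<^sup>2 \<le> d + e" using m[of n] by (auto simp: S_def)
  qed
  then have "norm (x - m) \<le> norm (x - y)" if "y \<in> M" for y
    using power2_le_imp_le[OF order_trans[OF _ d_le[OF that]] norm_ge_zero] by blast
  moreover have "m \<in> M" using m[of 0] by (simp add: S_def)
  ultimately show thesis using that by blast
qed

lemma orthogonal_decomposition:
  fixes M :: "'a::{real_inner, complete_space} set"
  assumes M: "subspace M" "closed M"
  obtains m where "m \<in> M" "\<And>y. y \<in> M \<Longrightarrow> inner (x - m) y = 0"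
proof -
  obtain m where m: "m \<in> M" "\<And>y. y \<in> M \<Longrightarrow> norm (x - m) \<le> norm (x - y)"
    using closest_point_in_closed_subspace[OF M] by blast
  have "inner (x - m) y = 0" if y: "y \<in> M" for y
  proof (cases "y = 0")
    case False
    \<comment> \<open>Moving from the closest point by the component of \<open>x - m\<close> along \<open>y\<close> decreases the squared
      distance by the square of that component.\<close>
    define c where "c = inner (x - m) y / inner y y"
    have c: "c * inner y y = inner (x - m) y" using False by (simp add: c_def)
    have "m + c *\<^sub>R y \<in> M" using m y M by (auto intro!: subspace_add subspace_scale)
    then have "(norm (x - m))\<^sup>2 \<le> (norm (x - m - c *\<^sub>R y))\<^sup>2"
      using m(2)[of "m + c *\<^sub>R y"] by (simp add: diff_diff_add)
    also have "\<dots> = (norm (x - m))\<^sup>2 - 2 * c * inner (x - m) y + c * (c * inner y y)"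
      unfolding power2_norm_eq_inner by (simp add: inner_commute algebra_simps)
    also have "\<dots> = (norm (x - m))\<^sup>2 - c * inner (x - m) y"
      unfolding c by simp
    finally have "c * (c * inner y y) \<le> 0" unfolding c by simp
    then have "c\<^sup>2 * inner y y \<le> 0" by (simp add: power2_eq_square mult.assoc)
    then have "c = 0"
      using False by (metis inner_gt_zero_iff linorder_not_less mult_pos_pos zero_less_power2)
    then show ?thesis using c by simp
  qed simp
  with m(1) show thesis using that by blast
qed

section \<open>The domain of the negative adjoint of a skew-symmetric operator\<close>

lemma mem_op_ker_one_minus [simp]: "x \<in> op_ker (one_minus T) \<longleftrightarrow> (x, x) \<in> T"
  by (auto simp: op_ker_def one_minus_def)

lemma mem_op_ker_one_plus [simp]: "x \<in> op_ker (one_plus T) \<longleftrightarrow> (x, - x) \<in> T"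
  by (auto simp: op_ker_def one_plus_def add_eq_0_iff)

locale skew_symmetric_operator =
  fixes A\<^sub>0 :: "('h::{real_inner, complete_space}) rel"
  assumes subspace_A0: "subspace A\<^sub>0"
    and dense: "densely_defined A\<^sub>0"
    and closed_A0: "closed A\<^sub>0"
    and skew: "skew_symmetric A\<^sub>0"
begin

abbreviation A where "A \<equiv> op_uminus (op_adjoint A\<^sub>0)"
abbreviation \<pi>\<^sub>1 where "\<pi>\<^sub>1 \<equiv> graph_proj A (op_ker (one_minus A))"
abbreviation \<pi>\<^sub>m where "\<pi>\<^sub>m \<equiv> graph_proj A (op_ker (one_plus A))"

text \<open>
  In this form \<open>A\<close> is the orthogonal complement in the product space of the graph of \<open>A\<^sub>0\<close> with
  its components swapped.
\<close>
lemma mem_A: "(x, y) \<in> A \<longleftrightarrow> (\<forall>u v. (u, v) \<in> A\<^sub>0 \<longrightarrow> inner v x + inner u y = 0)"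
proof -
  have "(x, y) \<in> A \<longleftrightarrow> (x, - y) \<in> op_adjoint A\<^sub>0"
    unfolding op_uminus_def by (force intro: exI[of _ "- y"])
  also have "\<dots> \<longleftrightarrow> (\<forall>u v. (u, v) \<in> A\<^sub>0 \<longrightarrow> inner v x + inner u y = 0)"
    unfolding op_adjoint_def by (auto simp: add_eq_0_iff2)
  finally show ?thesis .
qed

lemma A_extends: "(u, v) \<in> A\<^sub>0 \<Longrightarrow> (u, v) \<in> A"
  using skew by (auto simp: skew_symmetric_def)

lemma A_add: "(u, v) \<in> A \<Longrightarrow> (u', v') \<in> A \<Longrightarrow> (u + u', v + v') \<in> A"
  unfolding mem_A inner_add_right by (metis add.right_neutral add.assoc add.left_commute)

lemma A_scale: "(u, v) \<in> A \<Longrightarrow> (c *\<^sub>R u, c *\<^sub>R v) \<in> A"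
  unfolding mem_A by (auto simp: distrib_left[symmetric])

lemma A_diff: "(u, v) \<in> A \<Longrightarrow> (u', v') \<in> A \<Longrightarrow> (u - u', v - v') \<in> A"
  using A_add[OF _ A_scale[of u' v' "- 1"]] by simp

lemma A_single_valued:
  assumes "(x, y) \<in> A" "(x, y') \<in> A"
  shows "y = y'"
proof -
  have "Domain A\<^sub>0 \<subseteq> {u. inner u (y - y') = 0}"
    using assms unfolding mem_A by (force simp: inner_diff_right)
  moreover have "closed {u. inner u (y - y') = 0}"
    by (intro closed_Collect_eq continuous_intros)
  ultimately have "closure (Domain A\<^sub>0) \<subseteq> {u. inner u (y - y') = 0}"
    by (rule closure_minimal)
  then have "inner (y - y') (y - y') = 0"
    using dense unfolding densely_defined_def by blast
  then show ?thesis by simp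
qed

lemma op_apply_A: "(u, v) \<in> A \<Longrightarrow> op_apply A u = v"
  unfolding op_apply_def using A_single_valued by blast

text \<open>
  The graph-orthogonal decomposition of the domain of \<open>A\<close>, phrased for points of the graph: \<open>A\<close> is
  the identity on the component \<open>p\<close> and minus the identity on \<open>q\<close>.
\<close>
definition decomposed :: "'h \<Rightarrow> 'h \<Rightarrow> 'h \<Rightarrow> 'h \<Rightarrow> 'h \<Rightarrow> 'h \<Rightarrow> bool" where
  "decomposed u v u\<^sub>0 v\<^sub>0 p q \<longleftrightarrow> (u\<^sub>0, v\<^sub>0) \<in> A\<^sub>0 \<and> (p, p) \<in> A \<and> (q, - q) \<in> A
     \<and> u = u\<^sub>0 + p + q \<and> v = v\<^sub>0 + p - q"

lemma decomposed_imp_mem: "decomposed u v u\<^sub>0 v\<^sub>0 p q \<Longrightarrow> (u, v) \<in> A"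
  unfolding decomposed_def using A_add[OF A_add[OF A_extends]] by fastforce

text \<open>
  If \<open>(r, s)\<close> in the product space is orthogonal to \<open>A\<^sub>0\<close>, then \<open>(s, r)\<close> belongs to \<open>A\<close>. If
  moreover \<open>(r, s)\<close> is in \<open>A\<close>, then its symmetric and antisymmetric parts are in \<open>A\<close>, and these
  are the components in the two kernels.
\<close>
lemma ex_decomposed:
  assumes "(u, v) \<in> A"
  obtains u\<^sub>0 v\<^sub>0 p q where "decomposed u v u\<^sub>0 v\<^sub>0 p q"
proof -
  obtain m where m: "m \<in> A\<^sub>0" "\<And>y. y \<in> A\<^sub>0 \<Longrightarrow> inner ((u, v) - m) y = 0"
    using orthogonal_decomposition[OF subspace_A0 closed_A0, of "(u, v)"] by blast
  obtain u\<^sub>0 v\<^sub>0 where m_eq: "m = (u\<^sub>0, v\<^sub>0)" by (cases m)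
  note 0 = m(1)[unfolded m_eq] and orth = m(2)[unfolded m_eq]
  define r s where "r = u - u\<^sub>0" and "s = v - v\<^sub>0"
  have rs: "(r, s) \<in> A" unfolding r_def s_def using assms A_extends[OF 0] by (rule A_diff)
  have sr: "(s, r) \<in> A"
    unfolding mem_A using orth by (force simp: r_def s_def inner_commute)
  define p q where "p = (1/2) *\<^sub>R (r + s)" and "q = (1/2) *\<^sub>R (r - s)"
  have "(p, p) \<in> A"
    using A_scale[OF A_add[OF rs sr], of "1/2"] by (simp add: p_def add.commute)
  moreover have "(q, - q) \<in> A"
    using A_scale[OF A_diff[OF rs sr], of "1/2"]
    by (simp add: q_def flip: scaleR_minus_right)
  moreover have "p + q = r" "p - q = s"
    by (simp_all add: p_def q_def algebra_simps flip: scaleR_add_left)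
  then have "u = u\<^sub>0 + p + q" "v = v\<^sub>0 + p - q"
    by (simp_all add: r_def s_def algebra_simps)
  ultimately have "decomposed u v u\<^sub>0 v\<^sub>0 p q" using 0 by (simp add: decomposed_def)
  then show thesis by (rule that)
qed

lemma inner_A0_ker:
  assumes "(u\<^sub>0, v\<^sub>0) \<in> A\<^sub>0"
  shows "(p, p) \<in> A \<Longrightarrow> inner u\<^sub>0 p = - inner v\<^sub>0 p"
    and "(q, - q) \<in> A \<Longrightarrow> inner u\<^sub>0 q = inner v\<^sub>0 q"
  using assms unfolding mem_A by force+

text \<open>
  For \<open>w\<close> and \<open>z\<close> in the same kernel, orthogonality of the three components reduces the graph inner
  product of \<open>u - w\<close> and \<open>z\<close> to that of \<open>p - w\<close> (or \<open>q - w\<close>) and \<open>z\<close>, which is twice their inner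
  product. Testing with \<open>z = p - w\<close> (or \<open>z = q - w\<close>) gives uniqueness.
\<close>
lemma proj_decomposed:
  assumes "decomposed u v u\<^sub>0 v\<^sub>0 p q"
  shows "\<pi>\<^sub>1 u = p" and "\<pi>\<^sub>m u = q"
proof -
  note d = assms[unfolded decomposed_def]
  have uv: "(u, v) \<in> A" using assms by (rule decomposed_imp_mem)
  have inner1: "graph_inner A (u - w) z = 2 * inner (p - w) z"
    if "(w, w) \<in> A" "(z, z) \<in> A" for w z
  proof -
    have "graph_inner A (u - w) z = inner (u - w) z + inner (v - w) z"
      unfolding graph_inner_def op_apply_A[OF A_diff[OF uv that(1)]] op_apply_A[OF that(2)] ..
    then show ?thesis
      using d inner_A0_ker(1)[of u\<^sub>0 v\<^sub>0 z] that by (simp add: inner_simps)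
  qed
  have inner2: "graph_inner A (u - w) z = 2 * inner (q - w) z"
    if "(w, - w) \<in> A" "(z, - z) \<in> A" for w z
  proof -
    have "graph_inner A (u - w) z = inner (u - w) z + inner (v - (- w)) (- z)"
      unfolding graph_inner_def op_apply_A[OF A_diff[OF uv that(1)]] op_apply_A[OF that(2)] ..
    then show ?thesis
      using d inner_A0_ker(2)[of u\<^sub>0 v\<^sub>0 z] that by (simp add: inner_simps)
  qed
  show "\<pi>\<^sub>1 u = p"
    unfolding graph_proj_def
  proof (rule the_equality)
    fix w
    assume w: "w \<in> op_ker (one_minus A)
      \<and> (\<forall>z\<in>op_ker (one_minus A). graph_inner A (u - w) z = 0)"
    then have "(p - w, p - w) \<in> A" using d by (auto intro: A_diff)
    then have "2 * inner (p - w) (p - w) = 0" using w inner1 by force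
    then show "w = p" by simp
  qed (use d inner1[of p] in simp)
  show "\<pi>\<^sub>m u = q"
    unfolding graph_proj_def
  proof (rule the_equality)
    fix w
    assume w: "w \<in> op_ker (one_plus A)
      \<and> (\<forall>z\<in>op_ker (one_plus A). graph_inner A (u - w) z = 0)"
    then have "(q - w, - (q - w)) \<in> A" using d A_diff[of q "- q" w "- w"] by simp
    then have "2 * inner (q - w) (q - w) = 0" using w inner2 by force
    then show "w = q" by simp
  qed (use d inner2[of q] in simp)
qed

lemma decomposed_diff:
  "decomposed u v u\<^sub>0 v\<^sub>0 p q \<Longrightarrow> decomposed u' v' u\<^sub>0' v\<^sub>0' p' q'
   \<Longrightarrow> decomposed (u - u') (v - v') (u\<^sub>0 - u\<^sub>0') (v\<^sub>0 - v\<^sub>0') (p - p') (q - q')"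
  using subspace_diff[OF subspace_A0, of "(u\<^sub>0, v\<^sub>0)" "(u\<^sub>0', v\<^sub>0')"]
    A_diff[of p p p' p'] A_diff[of q "- q" q' "- q'"]
  by (auto simp: decomposed_def)

lemma proj_diff:
  assumes "(u, v) \<in> A" "(u', v') \<in> A"
  shows "\<pi>\<^sub>1 (u - u') = \<pi>\<^sub>1 u - \<pi>\<^sub>1 u'" and "\<pi>\<^sub>m (u - u') = \<pi>\<^sub>m u - \<pi>\<^sub>m u'"
proof -
  obtain u\<^sub>0 v\<^sub>0 p q where 1: "decomposed u v u\<^sub>0 v\<^sub>0 p q" using assms(1) by (rule ex_decomposed)
  obtain u\<^sub>0' v\<^sub>0' p' q' where 2: "decomposed u' v' u\<^sub>0' v\<^sub>0' p' q'"
    using assms(2) by (rule ex_decomposed)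
  note d = proj_decomposed[OF decomposed_diff[OF 1 2]]
  show "\<pi>\<^sub>1 (u - u') = \<pi>\<^sub>1 u - \<pi>\<^sub>1 u'" and "\<pi>\<^sub>m (u - u') = \<pi>\<^sub>m u - \<pi>\<^sub>m u'"
    unfolding d proj_decomposed[OF 1] proj_decomposed[OF 2] by (rule refl)+
qed

lemma proj_mem:
  assumes "(u, v) \<in> A"
  shows "(\<pi>\<^sub>1 u, \<pi>\<^sub>1 u) \<in> A" and "(\<pi>\<^sub>m u, - \<pi>\<^sub>m u) \<in> A"
proof -
  obtain u\<^sub>0 v\<^sub>0 p q where 1: "decomposed u v u\<^sub>0 v\<^sub>0 p q" using assms by (rule ex_decomposed)
  show "(\<pi>\<^sub>1 u, \<pi>\<^sub>1 u) \<in> A" and "(\<pi>\<^sub>m u, - \<pi>\<^sub>m u) \<in> A"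
    unfolding proj_decomposed[OF 1] using 1 by (simp_all add: decomposed_def)
qed

lemma zero_mem_A0: "(0, 0) \<in> A\<^sub>0"
  using subspace_0[OF subspace_A0] by (simp add: zero_prod_def)

lemma proj_ker_one_minus:
  assumes "(p, p) \<in> A"
  shows "\<pi>\<^sub>1 p = p"
  by (rule proj_decomposed(1)[of p p 0 0 p 0])
    (use assms A_extends[OF zero_mem_A0] zero_mem_A0 in \<open>simp add: decomposed_def\<close>)

lemma proj_ker_one_plus:
  assumes "(q, - q) \<in> A"
  shows "\<pi>\<^sub>1 q = 0" and "\<pi>\<^sub>m q = q"
proof -
  have "decomposed q (- q) 0 0 0 q"
    using assms A_extends[OF zero_mem_A0] zero_mem_A0 by (simp add: decomposed_def)
  then show "\<pi>\<^sub>1 q = 0" and "\<pi>\<^sub>m q = q" by (rule proj_decomposed)+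
qed

section \<open>Accretivity and solvability in terms of the two projections\<close>

text \<open>
  The cross terms between \<open>A\<^sub>0\<close> and the kernels cancel by orthogonality in the graph, those between
  the two kernels cancel by the opposite signs of \<open>A\<close> on them, and \<open>\<langle>A\<^sub>0 u\<^sub>0, u\<^sub>0\<rangle> = 0\<close> by skew-symmetry.
\<close>
lemma inner_eq_norm_proj_diff:
  assumes "(u, v) \<in> A"
  shows "inner v u = (norm (\<pi>\<^sub>1 u))\<^sup>2 - (norm (\<pi>\<^sub>m u))\<^sup>2"
proof -
  obtain u\<^sub>0 v\<^sub>0 p q where dec: "decomposed u v u\<^sub>0 v\<^sub>0 p q" using assms by (rule ex_decomposed)
  note d = dec[unfolded decomposed_def]
  have "inner v\<^sub>0 u\<^sub>0 = 0"
    using A_extends[of u\<^sub>0 v\<^sub>0] d unfolding mem_A by (force simp: inner_commute)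
  then show ?thesis
    unfolding proj_decomposed[OF dec] power2_norm_eq_inner
    using d inner_A0_ker[of u\<^sub>0 v\<^sub>0 p] inner_A0_ker[of u\<^sub>0 v\<^sub>0 q]
    by (simp add: inner_simps inner_commute)
qed

lemma accretive_iff_contraction:
  assumes "B \<subseteq> A"
  shows "accretive B \<longleftrightarrow>
    (\<forall>u\<in>Domain B. \<forall>x\<in>Domain B. norm (\<pi>\<^sub>m u - \<pi>\<^sub>m x) \<le> norm (\<pi>\<^sub>1 u - \<pi>\<^sub>1 x))"
proof -
  have "inner (y - v) (x - u) \<ge> 0 \<longleftrightarrow> norm (\<pi>\<^sub>m u - \<pi>\<^sub>m x) \<le> norm (\<pi>\<^sub>1 u - \<pi>\<^sub>1 x)"
    if "(u, v) \<in> B" "(x, y) \<in> B" for u v x y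
  proof -
    have m: "(u, v) \<in> A" "(x, y) \<in> A" using that assms by auto
    have "inner (y - v) (x - u) \<ge> 0
        \<longleftrightarrow> (norm (\<pi>\<^sub>m x - \<pi>\<^sub>m u))\<^sup>2 \<le> (norm (\<pi>\<^sub>1 x - \<pi>\<^sub>1 u))\<^sup>2"
      unfolding inner_eq_norm_proj_diff[OF A_diff[OF m(2,1)]] proj_diff[OF m(2,1)] by simp
    then show ?thesis by (simp add: norm_minus_commute)
  qed
  then show ?thesis unfolding accretive_def by blast
qed

text \<open>The difference of the two solutions lies in \<open>ker (1 + A)\<close>.\<close>
lemma same_image_imp:
  assumes "(u, v) \<in> A" "(u', v') \<in> A" "u + v = u' + v'"
  shows "\<pi>\<^sub>1 u = \<pi>\<^sub>1 u'" and "\<pi>\<^sub>m u - \<pi>\<^sub>m u' = u - u'"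
proof -
  have "v - v' = - (u - u')" using assms(3) by (simp add: algebra_simps)
  then have "(u - u', - (u - u')) \<in> A" using A_diff[OF assms(1,2)] by simp
  from proj_ker_one_plus[OF this] show "\<pi>\<^sub>1 u = \<pi>\<^sub>1 u'" and "\<pi>\<^sub>m u - \<pi>\<^sub>m u' = u - u'"
    unfolding proj_diff[OF assms(1,2)] by simp_all
qed

text \<open>
  As \<open>\<parallel>u\<^sub>0 + A\<^sub>0 u\<^sub>0\<parallel>\<^sup>2 = \<parallel>u\<^sub>0\<parallel>\<^sup>2 + \<parallel>A\<^sub>0 u\<^sub>0\<parallel>\<^sup>2\<close>, projecting \<open>f\<close> onto the range of \<open>1 + A\<^sub>0\<close> amounts to
  projecting \<open>(f, f)\<close> onto the graph of \<open>A\<^sub>0\<close>. The remainder \<open>f - (u\<^sub>0 + A\<^sub>0 u\<^sub>0)\<close> is in \<open>ker (1 - A)\<close>,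
  where \<open>1 + A\<close> is multiplication by two.
\<close>
lemma solve_with_prescribed_proj:
  assumes h: "\<And>p. (p, p) \<in> A \<Longrightarrow> (h p, - h p) \<in> A"
  obtains u v where "(u, v) \<in> A" "u + v = f" "\<pi>\<^sub>m u = h (\<pi>\<^sub>1 u)"
proof -
  obtain m where m: "m \<in> A\<^sub>0" "\<And>y. y \<in> A\<^sub>0 \<Longrightarrow> inner ((f, f) - m) y = 0"
    using orthogonal_decomposition[OF subspace_A0 closed_A0, of "(f, f)"] by blast
  obtain u\<^sub>0 v\<^sub>0 where m_eq: "m = (u\<^sub>0, v\<^sub>0)" by (cases m)
  note 0 = m(1)[unfolded m_eq] and orth = m(2)[unfolded m_eq]
  have "(f - v\<^sub>0, f - u\<^sub>0) \<in> A"
    unfolding mem_A using orth by (force simp: inner_commute)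
  from A_diff[OF this A_extends[OF 0]] have "(f - u\<^sub>0 - v\<^sub>0, f - u\<^sub>0 - v\<^sub>0) \<in> A"
    by (simp add: algebra_simps)
  define p where "p = (1/2) *\<^sub>R (f - u\<^sub>0 - v\<^sub>0)"
  have p: "(p, p) \<in> A" unfolding p_def by (rule A_scale) fact
  have dec: "decomposed (u\<^sub>0 + p + h p) (v\<^sub>0 + p - h p) u\<^sub>0 v\<^sub>0 p (h p)"
    using 0 p h by (simp add: decomposed_def)
  have "p + p = f - u\<^sub>0 - v\<^sub>0" by (simp add: p_def flip: scaleR_add_left)
  then have "(u\<^sub>0 + p + h p) + (v\<^sub>0 + p - h p) = f" by (simp add: algebra_simps)
  with decomposed_imp_mem[OF dec] show thesis
    by (rule that) (simp add: proj_decomposed[OF dec])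
qed

lemma m_accretive_iff_contraction:
  assumes "B \<subseteq> A"
  shows "m_accretive B \<longleftrightarrow>
    (\<exists>h \<in> op_ker (one_minus A) \<rightarrow> op_ker (one_plus A).
      (\<forall>x \<in> op_ker (one_minus A). \<forall>y \<in> op_ker (one_minus A). norm (h x - h y) \<le> norm (x - y)) \<and>
      Domain B = {u \<in> Domain A. h (\<pi>\<^sub>1 u) = \<pi>\<^sub>m u})"
proof
  assume m: "m_accretive B"
  have contr: "norm (\<pi>\<^sub>m u - \<pi>\<^sub>m x) \<le> norm (\<pi>\<^sub>1 u - \<pi>\<^sub>1 x)"
    if "u \<in> Domain B" "x \<in> Domain B" for u x
    using m that accretive_iff_contraction[OF assms] unfolding m_accretive_def by blast
  have onto: "\<exists>u v. (u, v) \<in> B \<and> u + v = f" for f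
  proof -
    have "f \<in> Range (one_plus B)" using m by (simp add: m_accretive_def)
    then show ?thesis by (auto simp: one_plus_def)
  qed
  \<comment> \<open>The equation with right-hand side \<open>2 p\<close> is solved in \<open>A\<close> by \<open>p\<close>, so its solution in \<open>B\<close>
    also projects to \<open>p\<close>.\<close>
  have "\<exists>u\<in>Domain B. \<pi>\<^sub>1 u = p" if p: "(p, p) \<in> A" for p
  proof -
    obtain u v where uv: "(u, v) \<in> B" "u + v = p + p" using onto by blast
    then have "\<pi>\<^sub>1 u = \<pi>\<^sub>1 p" using same_image_imp(1)[OF _ p] assms by blast
    with uv proj_ker_one_minus[OF p] show ?thesis by auto
  qed
  then obtain g where g: "\<And>p. (p, p) \<in> A \<Longrightarrow> g p \<in> Domain B \<and> \<pi>\<^sub>1 (g p) = p"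
    by metis
  define h where "h p = \<pi>\<^sub>m (g p)" for p
  have h_proj: "h (\<pi>\<^sub>1 u) = \<pi>\<^sub>m u" if "u \<in> Domain B" for u
  proof -
    have "(\<pi>\<^sub>1 u, \<pi>\<^sub>1 u) \<in> A" using that assms proj_mem(1) by blast
    from g[OF this] contr[of "g (\<pi>\<^sub>1 u)" u] that show ?thesis by (simp add: h_def)
  qed
  show "\<exists>h \<in> op_ker (one_minus A) \<rightarrow> op_ker (one_plus A).
      (\<forall>x \<in> op_ker (one_minus A). \<forall>y \<in> op_ker (one_minus A). norm (h x - h y) \<le> norm (x - y)) \<and>
      Domain B = {u \<in> Domain A. h (\<pi>\<^sub>1 u) = \<pi>\<^sub>m u}"
  proof (intro bexI conjI ballI)
    show "h \<in> op_ker (one_minus A) \<rightarrow> op_ker (one_plus A)"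
    proof
      fix p assume "p \<in> op_ker (one_minus A)"
      then obtain w where "(g p, w) \<in> A" using g assms by (auto simp: Domain_iff)
      then show "h p \<in> op_ker (one_plus A)" using proj_mem(2) by (simp add: h_def)
    qed
    show "norm (h x - h y) \<le> norm (x - y)"
      if "x \<in> op_ker (one_minus A)" "y \<in> op_ker (one_minus A)" for x y
      using that g[of x] g[of y] contr[of "g x" "g y"] by (simp add: h_def)
    show "Domain B = {u \<in> Domain A. h (\<pi>\<^sub>1 u) = \<pi>\<^sub>m u}"
    proof (intro equalityI subsetI)
      fix u assume "u \<in> Domain B"
      then show "u \<in> {u \<in> Domain A. h (\<pi>\<^sub>1 u) = \<pi>\<^sub>m u}" using h_proj assms by blast
    next
      fix u assume "u \<in> {u \<in> Domain A. h (\<pi>\<^sub>1 u) = \<pi>\<^sub>m u}"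
      then obtain v where uv: "(u, v) \<in> A" and hu: "h (\<pi>\<^sub>1 u) = \<pi>\<^sub>m u" by auto
      obtain u' v' where uv': "(u', v') \<in> B" "u' + v' = u + v" using onto by blast
      then have "(u', v') \<in> A" using assms by auto
      from same_image_imp[OF this uv uv'(2)] have "u = u'"
        using h_proj[of u'] hu DomainI[OF uv'(1)] by simp
      with uv' show "u \<in> Domain B" by auto
    qed
  qed
next
  assume "\<exists>h \<in> op_ker (one_minus A) \<rightarrow> op_ker (one_plus A).
      (\<forall>x \<in> op_ker (one_minus A). \<forall>y \<in> op_ker (one_minus A). norm (h x - h y) \<le> norm (x - y)) \<and>
      Domain B = {u \<in> Domain A. h (\<pi>\<^sub>1 u) = \<pi>\<^sub>m u}"
  then obtain h where h_Pi: "h \<in> op_ker (one_minus A) \<rightarrow> op_ker (one_plus A)"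
    and h_contr: "\<forall>x \<in> op_ker (one_minus A). \<forall>y \<in> op_ker (one_minus A).
      norm (h x - h y) \<le> norm (x - y)"
    and dom: "Domain B = {u \<in> Domain A. h (\<pi>\<^sub>1 u) = \<pi>\<^sub>m u}"
    by blast
  have h: "(h p, - h p) \<in> A" if "(p, p) \<in> A" for p
    using funcset_mem[OF h_Pi, of p] that by simp
  have contr: "norm (h x - h y) \<le> norm (x - y)" if "(x, x) \<in> A" "(y, y) \<in> A" for x y
    using bspec[OF bspec[OF h_contr, of x], of y] that by simp
  have "norm (\<pi>\<^sub>m u - \<pi>\<^sub>m x) \<le> norm (\<pi>\<^sub>1 u - \<pi>\<^sub>1 x)"
    if "u \<in> Domain B" "x \<in> Domain B" for u x
  proof -
    have "(\<pi>\<^sub>1 u, \<pi>\<^sub>1 u) \<in> A" "(\<pi>\<^sub>1 x, \<pi>\<^sub>1 x) \<in> A" using that dom proj_mem(1) by blast+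
    from contr[OF this] that show ?thesis by (simp add: dom)
  qed
  then have "accretive B" using accretive_iff_contraction[OF assms] by blast
  moreover have "f \<in> Range (one_plus B)" for f
  proof -
    obtain u v where uv: "(u, v) \<in> A" "u + v = f" "\<pi>\<^sub>m u = h (\<pi>\<^sub>1 u)"
      using solve_with_prescribed_proj[of h, OF h] by blast
    then have "u \<in> Domain B" unfolding dom by auto
    then have "(u, v) \<in> B" using A_single_valued[OF uv(1)] assms by blast
    with uv(2) show ?thesis unfolding one_plus_def by blast
  qed
  ultimately show "m_accretive B" unfolding m_accretive_def by blast
qed

end

theorem theorem3p1:
  fixes A\<^sub>0 A B :: "('h::{real_inner, complete_space}) rel"
  assumes "linear_operator A\<^sub>0"
    and "densely_defined A\<^sub>0"
    and "closed A\<^sub>0"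
    and "skew_symmetric A\<^sub>0"
    and "A = op_uminus (op_adjoint A\<^sub>0)"
    and "B \<subseteq> A"
  shows "m_accretive B \<longleftrightarrow>
    (\<exists>h \<in> op_ker (one_minus A) \<rightarrow> op_ker (one_plus A).
      (\<forall>x \<in> op_ker (one_minus A). \<forall>y \<in> op_ker (one_minus A). norm (h x - h y) \<le> norm (x - y)) \<and>
      Domain B = {u \<in> Domain A. h (graph_proj A (op_ker (one_minus A)) u)
                                = graph_proj A (op_ker (one_plus A)) u})"
proof -
  interpret skew_symmetric_operator A\<^sub>0
    using assms by unfold_locales (auto simp: linear_operator_def)
  show ?thesis
    using m_accretive_iff_contraction assms(6) unfolding assms(5) .
qed

end
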